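(* For any integers $a,b$ with $2\le a\le b$, there exists a graph $G$ with $\mathrm{gp}_{\mathrm g}(G)=a$ and $\mathrm{gp}_{\mathrm g}'(G)=b$.
   Context: All graphs are finite, simple and undirected. A set $S\subseteq V(G)$ is in general position if no shortest path of $G$ contains more than two vertices of $S$. In the Builder-Blocker general position game on a graph $G$, two players, Builder and Blocker, alternately choose (mark) an unmarked vertex of $G$ so that at each stage the set of all marked vertices is in general position; the game ends when no further vertex can be selected. Builder aims to make the final set of marked vertices as large as possible, Blocker as small as possible. In the B-game Builder moves first; in the B'-game Blocker moves first. $\mathrm{gp}_{\mathrm g}(G)$ (respectively $\mathrm{gp}_{\mathrm g}'(G)$) is the number of vertices in the final set when the B-game (respectively B'-game) is played optimally by both players. *)

theory Defs
  imports "Graph_Theory.Graph_Theory"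
begin

text \<open>
  A finite simple undirected graph is a \<^locale>\<open>pair_graph\<close>: a finite vertex set together with a
  symmetric irreflexive relation on it.
\<close>

definition shortest_path :: "'a pair_pre_digraph \<Rightarrow> 'a list \<Rightarrow> bool" where
  "shortest_path G p \<longleftrightarrow> vpath p G \<and>
     (\<forall>q. vpath q G \<and> hd q = hd p \<and> last q = last p \<longrightarrow> vwalk_length p \<le> vwalk_length q)"

definition general_position :: "'a pair_pre_digraph \<Rightarrow> 'a set \<Rightarrow> bool" where
  "general_position G S \<longleftrightarrow> S \<subseteq> pverts G \<and> (\<forall>p. shortest_path G p \<longrightarrow> card (S \<inter> set p) \<le> 2)"

definition legal_moves :: "'a pair_pre_digraph \<Rightarrow> 'a set \<Rightarrow> 'a set" where
  "legal_moves G S = {v \<in> pverts G - S. general_position G (insert v S)}"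

datatype player = Builder | Blocker

text \<open>
  \<open>game_value G P S\<close> is the number of vertices marked at the end of the game under optimal play
  from the position in which the vertices of \<open>S\<close> are marked and player \<open>P\<close> is to move.
  The guard \<^term>\<open>infinite (pverts G)\<close> only serves to make the recursion well-founded.
\<close>

function game_value :: "'a pair_pre_digraph \<Rightarrow> player \<Rightarrow> 'a set \<Rightarrow> nat" where
  "game_value G P S =
     (if infinite (pverts G) \<or> legal_moves G S = {} then card S
      else case P of
        Builder \<Rightarrow> Max ((\<lambda>v. game_value G Blocker (insert v S)) ` legal_moves G S)
      | Blocker \<Rightarrow> Min ((\<lambda>v. game_value G Builder (insert v S)) ` legal_moves G S))"
  by pat_completeness auto
termination
proof (relation "measure (\<lambda>(G, P, S). card (pverts G - S))")
  have "card (pverts G - insert v S) < card (pverts G - S)"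
    if "\<not> (infinite (pverts G) \<or> legal_moves G S = {})" "v \<in> legal_moves G S"
    for G :: "'a pair_pre_digraph" and S v
    using that by (intro psubset_card_mono) (auto simp: legal_moves_def)
  then show "\<And>G P S v. \<not> (infinite (pverts G) \<or> legal_moves G S = {}) \<Longrightarrow> P = Builder \<Longrightarrow>
      v \<in> legal_moves G S \<Longrightarrow>
      ((G, Blocker, insert v S), (G :: 'a pair_pre_digraph, P, S))
        \<in> measure (\<lambda>(G, P, S). card (pverts G - S))"
    and "\<And>G P S v. \<not> (infinite (pverts G) \<or> legal_moves G S = {}) \<Longrightarrow> P = Blocker \<Longrightarrow>
      v \<in> legal_moves G S \<Longrightarrow>
      ((G, Builder, insert v S), (G :: 'a pair_pre_digraph, P, S))
        \<in> measure (\<lambda>(G, P, S). card (pverts G - S))"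
    by auto
qed simp

declare game_value.simps [simp del]

definition gp_g :: "'a pair_pre_digraph \<Rightarrow> nat" where
  "gp_g G = game_value G Builder {}"

definition gp_g' :: "'a pair_pre_digraph \<Rightarrow> nat" where
  "gp_g' G = game_value G Blocker {}"

end

theory Submission
  imports Defs
begin

text \<open>
  The witness is the complete multipartite graph with \<open>a\<close> parts of \<open>b\<close> vertices each. Two of its
  vertices in the same part are at distance \<open>2\<close>, and any vertex of another part is a midpoint
  between them; all other pairs of distinct vertices are adjacent. Hence a set is in general
  position exactly when it lies inside one part or meets every part at most once
  (\<open>general_position_multipartite_iff\<close>).

  The second vertex to be marked therefore decides the game. If it lies in the part of the first
  vertex, then play continues inside that part until all its \<open>b\<close> vertices are marked; otherwise it
  continues with vertices of new parts until all \<open>a\<close> parts are represented. By symmetry, the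
  choice of the first vertex is immaterial, so the player who moves second selects between \<open>a\<close> and
  \<open>b\<close>: since \<open>a \<le> b\<close>, Blocker takes \<open>a\<close> in the B-game and Builder takes \<open>b\<close> in the B'-game.
\<close>

section \<open>Games whose outcome does not depend on play\<close>

text \<open>
  When a property of positions survives every move and fixes the size of a final position, the
  value is determined, whoever is to move. This settles the play once two vertices are marked.
\<close>

lemma game_value_forced:
  assumes "finite (pverts G)" and "\<Phi> S"
    and step: "\<And>T v. \<Phi> T \<Longrightarrow> v \<in> legal_moves G T \<Longrightarrow> \<Phi> (insert v T)"
    and final: "\<And>T. \<Phi> T \<Longrightarrow> legal_moves G T = {} \<Longrightarrow> card T = n"
  shows "game_value G P S = n"
  using assms(1,2) step final
proof (induction G P S rule: game_value.induct)
  case (1 G P S)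
  note fin = 1(3) and \<Phi> = 1(4) and step = 1(5) and final = 1(6)
  show ?case
  proof (cases "legal_moves G S = {}")
    case True
    then show ?thesis
      using final[OF \<Phi> True] by (simp add: game_value.simps)
  next
    case False
    have "game_value G Q (insert v S) = n" if "v \<in> legal_moves G S" "Q \<noteq> P" for v Q
    proof (cases Q)
      case Builder
      then have "P = Blocker" using that(2) by (cases P) auto
      then show ?thesis
        using 1(2)[OF _ _ that(1)] False fin step[OF \<Phi> that(1)] step final Builder by blast
    next
      case Blocker
      then have "P = Builder" using that(2) by (cases P) auto
      then show ?thesis
        using 1(1)[OF _ _ that(1)] False fin step[OF \<Phi> that(1)] step final Blocker by blast
    qed
    then show ?thesis
      using False fin by (cases P) (simp_all add: game_value.simps[of G _ S] image_constant_conv)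
  qed
qed

section \<open>Geodesics of a balanced complete multipartite graph\<close>

text \<open>The parts are the \<open>a\<close> consecutive intervals of length \<open>b\<close>, so \<open>x div b\<close> is the part of \<open>x\<close>.\<close>

definition multipartite :: "nat \<Rightarrow> nat \<Rightarrow> nat pair_pre_digraph" where
  "multipartite a b = \<lparr>pverts = {..<a * b},
     parcs = {(x, y). x < a * b \<and> y < a * b \<and> x div b \<noteq> y div b}\<rparr>"

lemma pverts_multipartite [simp]: "pverts (multipartite a b) = {..<a * b}"
  and parcs_multipartite [simp]: "parcs (multipartite a b) =
    {(x, y). x < a * b \<and> y < a * b \<and> x div b \<noteq> y div b}"
  by (simp_all add: multipartite_def)

lemma pair_graph_multipartite: "pair_graph (multipartite a b)"
proof
  have "parcs (multipartite a b) \<subseteq> {..<a * b} \<times> {..<a * b}"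
    by auto
  then show "finite (parcs (multipartite a b))"
    by (rule finite_subset) simp
  show "symmetric (with_proj (multipartite a b))"
    by (auto simp: symmetric_def sym_def)
qed auto

lemma div_less_parts: "x div b < a" if "x < a * b" for x a b :: nat
  using that by (simp add: less_mult_imp_div_less)

lemma part_inhabited: "r * b < a * b \<and> r * b div b = r" if "r < a" "0 < b" for r a b :: nat
  using that by simp

lemma card_part: "card {x. x < a * b \<and> x div b = r} = b" if "r < a" for r a b :: nat
proof (cases "b = 0")
  case False
  have interval: "x div b = r \<longleftrightarrow> r * b \<le> x \<and> x < Suc r * b" for x
  proof -
    have "x div b = r \<longleftrightarrow> r \<le> x div b \<and> x div b < Suc r"
      by auto
    also have "\<dots> \<longleftrightarrow> r * b \<le> x \<and> x < Suc r * b"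
      using False by (simp only: less_eq_div_iff_mult_less_eq div_less_iff_less_mult neq0_conv)
    finally show ?thesis .
  qed
  have "Suc r * b \<le> a * b"
    using that by (intro mult_right_mono) auto
  then have "{x. x < a * b \<and> x div b = r} = {r * b..<Suc r * b}"
    unfolding interval set_eq_iff mem_Collect_eq atLeastLessThan_iff by (meson less_le_trans)
  then show ?thesis
    by simp
qed simp

lemma vpath_multipartite_edge:
  assumes "x < a * b" "z < a * b" "x div b \<noteq> z div b"
  shows "vpath [x, z] (with_proj (multipartite a b))"
  using assms by (auto simp: vpath_def vwalk_def)

lemma vpath_multipartite_cherry:
  assumes "x < a * b" "y < a * b" "z < a * b" "x \<noteq> z"
    and "x div b \<noteq> y div b" "z div b \<noteq> y div b"
  shows "vpath [x, y, z] (with_proj (multipartite a b))"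
  using assms by (auto simp: vpath_def vwalk_def)

text \<open>Nonadjacent vertices are not joined by a path with one edge, so any common neighbour will do.\<close>

lemma shortest_path_multipartite_cherry:
  assumes "x < a * b" "y < a * b" "z < a * b" "x \<noteq> z"
    and "x div b = z div b" "x div b \<noteq> y div b"
  shows "shortest_path (multipartite a b) [x, y, z]"
proof -
  have "3 \<le> length q"
    if "vpath q (with_proj (multipartite a b))" "hd q = x" "last q = z" for q
  proof (rule ccontr)
    assume "\<not> 3 \<le> length q"
    then consider "q = []" | u where "q = [u]" | u v where "q = [u, v]"
      by (cases q rule: list.exhaust; cases "tl q" rule: list.exhaust;
          cases "tl (tl q)" rule: list.exhaust) auto
    then show False
      using that assms by cases (auto simp: vpath_def vwalk_def)
  qed
  then show ?thesis
    using assms vpath_multipartite_cherry[of x a b y z]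
    by (fastforce simp: shortest_path_def)
qed

text \<open>
  With at least two parts the diameter is at most \<open>2\<close>, so the geodesics with three or more vertices have
  precisely three, and these form an induced path.
\<close>

lemma shortest_path_multipartite_cases:
  assumes "2 \<le> a" and p: "shortest_path (multipartite a b) p" and "3 \<le> length p"
  obtains x y z where "p = [x, y, z]" "x div b = z div b" "x div b \<noteq> y div b"
proof -
  define x z where "x = hd p" and "z = last p"
  have minimal: "length p - 1 \<le> length q - 1"
      if "vpath q (with_proj (multipartite a b))" "hd q = x" "last q = z" for q
    using p that by (auto simp: shortest_path_def x_def z_def)
  have path: "vpath p (with_proj (multipartite a b))"
    using p by (simp add: shortest_path_def)
  obtain y w ps where p_eq: "p = x # y # w # ps"
    using \<open>3 \<le> length p\<close> unfolding x_def
    by (cases p rule: list.exhaust; cases "tl p" rule: list.exhaust;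
        cases "tl (tl p)" rule: list.exhaust) auto
  have "x \<noteq> z"
    using path p_eq by (auto simp: vpath_def z_def split: if_splits)
  have "z \<in> set p"
    using p_eq by (simp add: z_def)
  then have verts: "x < a * b" "z < a * b" and xy: "x div b \<noteq> y div b"
    using path p_eq by (auto simp: vpath_def vwalk_def)
  have xz: "x div b = z div b"
    using minimal[of "[x, z]"] vpath_multipartite_edge[OF verts] p_eq by auto
  obtain r where r: "r < a" "r \<noteq> x div b"
    using \<open>2 \<le> a\<close> by (metis One_nat_def Suc_1 Suc_le_lessD less_trans zero_less_Suc zero_neq_one)
  have "0 < b"
    using verts by (cases b) auto
  have "vpath [x, r * b, z] (with_proj (multipartite a b))"
    using r part_inhabited[OF r(1) \<open>0 < b\<close>] verts \<open>x \<noteq> z\<close> xz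
    by (intro vpath_multipartite_cherry) auto
  from minimal[OF this] have "ps = []"
    using p_eq by simp
  then show ?thesis
    using that p_eq xz xy by (simp add: z_def)
qed

section \<open>General position\<close>

definition in_one_part :: "nat \<Rightarrow> nat set \<Rightarrow> bool" where
  "in_one_part b S \<longleftrightarrow> (\<exists>r. \<forall>x\<in>S. x div b = r)"

text \<open>
  A set that is neither contained in a part nor a partial transversal contains two vertices of one
  part and a vertex of another part, and the latter is a midpoint of the former two.
\<close>

lemma general_position_multipartite_iff:
  assumes "2 \<le> a"
  shows "general_position (multipartite a b) S \<longleftrightarrow>
    S \<subseteq> {..<a * b} \<and> (in_one_part b S \<or> inj_on (\<lambda>x. x div b) S)"
proof (intro iffI conjI)
  assume gp: "general_position (multipartite a b) S"
  then show sub: "S \<subseteq> {..<a * b}"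
    by (simp add: general_position_def)
  show "in_one_part b S \<or> inj_on (\<lambda>x. x div b) S"
  proof (rule ccontr)
    assume "\<not> ?thesis"
    then obtain x z where xz: "x \<in> S" "z \<in> S" "x \<noteq> z" "x div b = z div b"
      and "\<not> in_one_part b S"
      by (auto simp: inj_on_def)
    then obtain y where y: "y \<in> S" "y div b \<noteq> x div b"
      by (auto simp: in_one_part_def)
    have "shortest_path (multipartite a b) [x, y, z]"
      using xz y sub by (intro shortest_path_multipartite_cherry) auto
    moreover have "card (S \<inter> set [x, y, z]) = 3"
    proof -
      have "S \<inter> set [x, y, z] = {x, y, z}"
        using xz y by auto
      moreover have "x \<noteq> y" "y \<noteq> z"
        using xz y by auto
      ultimately show ?thesis
        using xz by simp
    qed
    ultimately show False
      using gp by (fastforce simp: general_position_def)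
  qed
next
  assume S: "S \<subseteq> {..<a * b} \<and> (in_one_part b S \<or> inj_on (\<lambda>x. x div b) S)"
  have "card (S \<inter> set p) \<le> 2" if p: "shortest_path (multipartite a b) p" for p
  proof (rule ccontr)
    assume many: "\<not> card (S \<inter> set p) \<le> 2"
    have "card (S \<inter> set p) \<le> card (set p)"
      by (intro card_mono) auto
    also have "\<dots> \<le> length p"
      by (rule card_length)
    finally have "3 \<le> length p"
      using many by simp
    with assms p obtain x y z
      where xyz: "p = [x, y, z]" "x div b = z div b" "x div b \<noteq> y div b"
      by (rule shortest_path_multipartite_cases)
    have "distinct p"
      using p by (simp add: shortest_path_def vpath_def)
    have "set p \<subseteq> S"
    proof (rule ccontr)
      assume "\<not> set p \<subseteq> S"
      then have "S \<inter> set p \<subset> set p"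
        by blast
      then have "card (S \<inter> set p) < card (set p)"
        by (intro psubset_card_mono) auto
      then show False
        using many \<open>distinct p\<close> xyz(1) by (simp add: distinct_card)
    qed
    then show False
      using S xyz \<open>distinct p\<close> by (auto simp: in_one_part_def inj_on_def)
  qed
  then show "general_position (multipartite a b) S"
    using S by (simp add: general_position_def)
qed

lemma legal_moves_multipartite:
  assumes "2 \<le> a" and "S \<subseteq> {..<a * b}"
  shows "legal_moves (multipartite a b) S =
    {v. v < a * b \<and> v \<notin> S \<and>
        (in_one_part b (insert v S) \<or> inj_on (\<lambda>x. x div b) (insert v S))}"
  using assms(2) by (auto simp: legal_moves_def general_position_multipartite_iff[OF assms(1)])

section \<open>The outcome of the two games\<close>

text \<open>
  The invariants of the next two lemmas retain the first two marked vertices: these rule out one of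
  the two kinds of sets in general position for the rest of the game.
\<close>

lemma game_value_one_part:
  assumes "2 \<le> a" and "x < a * b" "y < a * b" "x \<noteq> y" "x div b = y div b"
  shows "game_value (multipartite a b) P {x, y} = b"
proof (rule game_value_forced[where
      \<Phi> = "\<lambda>T. {x, y} \<subseteq> T \<and> T \<subseteq> {v. v < a * b \<and> v div b = x div b}"])
  fix T v
  assume T: "{x, y} \<subseteq> T \<and> T \<subseteq> {v. v < a * b \<and> v div b = x div b}"
    and v: "v \<in> legal_moves (multipartite a b) T"
  have sub: "T \<subseteq> {..<a * b}"
    using T by auto
  have "\<not> inj_on (\<lambda>x. x div b) (insert v T)"
    using T assms(4,5) by (auto simp: inj_on_def)
  then have "in_one_part b (insert v T)" and "v < a * b"
    using v unfolding legal_moves_multipartite[OF assms(1) sub] by blast+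
  then show "{x, y} \<subseteq> insert v T \<and> insert v T \<subseteq> {v. v < a * b \<and> v div b = x div b}"
    using T by (auto simp: in_one_part_def)
next
  fix T
  assume T: "{x, y} \<subseteq> T \<and> T \<subseteq> {v. v < a * b \<and> v div b = x div b}"
    and stuck: "legal_moves (multipartite a b) T = {}"
  have sub: "T \<subseteq> {..<a * b}"
    using T by auto
  have "v \<in> T" if "v < a * b" "v div b = x div b" for v
  proof (rule ccontr)
    assume "v \<notin> T"
    have "in_one_part b (insert v T)"
      using T that by (auto simp: in_one_part_def)
    then show False
      using stuck that \<open>v \<notin> T\<close> unfolding legal_moves_multipartite[OF assms(1) sub] by blast
  qed
  then have "T = {v. v < a * b \<and> v div b = x div b}"
    using T by auto
  then show "card T = b"
    using card_part[OF div_less_parts[OF assms(2)]] by simp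
qed (use assms in auto)

lemma game_value_transversal:
  assumes "2 \<le> a" and "x < a * b" "y < a * b" "x div b \<noteq> y div b"
  shows "game_value (multipartite a b) P {x, y} = a"
proof (rule game_value_forced[where
      \<Phi> = "\<lambda>T. {x, y} \<subseteq> T \<and> T \<subseteq> {..<a * b} \<and> inj_on (\<lambda>v. v div b) T"])
  fix T v
  assume T: "{x, y} \<subseteq> T \<and> T \<subseteq> {..<a * b} \<and> inj_on (\<lambda>v. v div b) T"
    and v: "v \<in> legal_moves (multipartite a b) T"
  have "\<not> in_one_part b (insert v T)"
    using T assms(4) unfolding in_one_part_def by (metis insert_iff insert_subset)
  then show "{x, y} \<subseteq> insert v T \<and> insert v T \<subseteq> {..<a * b} \<and> inj_on (\<lambda>v. v div b) (insert v T)"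
    using T v by (auto simp: legal_moves_multipartite[OF assms(1)])
next
  fix T
  assume T: "{x, y} \<subseteq> T \<and> T \<subseteq> {..<a * b} \<and> inj_on (\<lambda>v. v div b) T"
    and stuck: "legal_moves (multipartite a b) T = {}"
  have "0 < b"
    using assms(2) by (cases b) auto
  have "r \<in> (\<lambda>v. v div b) ` T" if "r < a" for r
  proof (rule ccontr)
    assume new: "r \<notin> (\<lambda>v. v div b) ` T"
    note rb = part_inhabited[OF that \<open>0 < b\<close>]
    have "r * b \<notin> T"
      using new rb by (metis imageI)
    moreover have "inj_on (\<lambda>v. v div b) (insert (r * b) T)"
      using T new rb \<open>r * b \<notin> T\<close> by (simp add: inj_on_insert)
    ultimately have "r * b \<in> legal_moves (multipartite a b) T"
      using T rb by (simp add: legal_moves_multipartite[OF assms(1)])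
    then show False
      using stuck by simp
  qed
  then have "(\<lambda>v. v div b) ` T = {..<a}"
    using T div_less_parts by auto
  then show "card T = a"
    using T card_image[of "\<lambda>v. v div b" T] by simp
qed (use assms in auto)

text \<open>
  As \<open>a \<ge> 2\<close> and \<open>b \<ge> 2\<close>, the second player can always reply inside as well as outside the part
  of the first marked vertex, so both outcomes are on offer.
\<close>

lemma outcomes_after_first_move:
  assumes "2 \<le> a" "2 \<le> b" and "x < a * b"
  shows "(\<lambda>v. game_value (multipartite a b) P (insert v {x})) `
    legal_moves (multipartite a b) {x} = {a, b}"
proof -
  have moves: "legal_moves (multipartite a b) {x} = {v. v < a * b \<and> v \<noteq> x}"
    using assms(3) by (auto simp: legal_moves_multipartite[OF assms(1)] in_one_part_def inj_on_def)
  have outcome: "game_value (multipartite a b) P (insert v {x}) =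
      (if v div b = x div b then b else a)" if "v < a * b" "v \<noteq> x" for v
    using that assms game_value_one_part game_value_transversal by simp
  obtain y where y: "y < a * b" "y \<noteq> x" "y div b = x div b"
  proof -
    have "\<not> {v. v < a * b \<and> v div b = x div b} \<subseteq> {x}"
      using card_mono[of "{x}" "{v. v < a * b \<and> v div b = x div b}"]
        card_part[OF div_less_parts[OF assms(3)]] assms(2) by auto
    then show ?thesis
      using that by auto
  qed
  obtain z where z: "z < a * b" "z div b \<noteq> x div b"
  proof -
    obtain r where r: "r < a" "r \<noteq> x div b"
      using assms(1) by (metis One_nat_def Suc_1 Suc_le_lessD less_trans zero_less_Suc zero_neq_one)
    then show ?thesis
      using that[of "r * b"] part_inhabited[OF r(1), of b] assms(2) by simp
  qed
  show ?thesis
  proof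
    show "(\<lambda>v. game_value (multipartite a b) P (insert v {x})) `
        legal_moves (multipartite a b) {x} \<subseteq> {a, b}"
      using outcome moves by auto
    have "z \<noteq> x"
      using z by auto
    then have "z \<in> legal_moves (multipartite a b) {x}" "y \<in> legal_moves (multipartite a b) {x}"
      using y z unfolding moves by simp_all
    moreover have "game_value (multipartite a b) P (insert z {x}) = a"
      and "game_value (multipartite a b) P (insert y {x}) = b"
      using outcome[OF y(1,2)] outcome[OF z(1) \<open>z \<noteq> x\<close>] y(3) z(2) by simp_all
    ultimately show "{a, b} \<subseteq> (\<lambda>v. game_value (multipartite a b) P (insert v {x})) `
        legal_moves (multipartite a b) {x}"
      by (metis empty_subsetI image_eqI insert_subset)
  qed
qed

lemma game_value_after_first_move:
  assumes "2 \<le> a" "2 \<le> b" and "x < a * b"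
  shows "game_value (multipartite a b) Blocker {x} = min a b"
    and "game_value (multipartite a b) Builder {x} = max a b"
proof -
  have "legal_moves (multipartite a b) {x} \<noteq> {}"
    using outcomes_after_first_move[OF assms, of Builder] by auto
  then show "game_value (multipartite a b) Blocker {x} = min a b"
    and "game_value (multipartite a b) Builder {x} = max a b"
    using outcomes_after_first_move[OF assms]
    by (simp_all add: game_value.simps[of _ _ "{x}"])
qed

lemma
  assumes "2 \<le> a" "2 \<le> b"
  shows gp_g_multipartite: "gp_g (multipartite a b) = min a b"
    and gp_g'_multipartite: "gp_g' (multipartite a b) = max a b"
proof -
  have moves: "legal_moves (multipartite a b) {} = {..<a * b}"
    by (auto simp: legal_moves_multipartite[OF assms(1)] in_one_part_def)
  have "{..<a * b} \<noteq> {}"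
    using assms by (auto simp: lessThan_empty_iff)
  then show "gp_g (multipartite a b) = min a b" and "gp_g' (multipartite a b) = max a b"
    using game_value_after_first_move[OF assms]
    by (simp_all add: gp_g_def gp_g'_def game_value.simps[of _ _ "{}"] moves image_constant_conv
        cong: image_cong_simp)
qed

theorem proposition4p1:
  fixes a b :: nat
  assumes "2 \<le> a" and "a \<le> b"
  shows "\<exists>G :: nat pair_pre_digraph. pair_graph G \<and> gp_g G = a \<and> gp_g' G = b"
proof (intro exI conjI)
  show "pair_graph (multipartite a b)"
    by (rule pair_graph_multipartite)
  show "gp_g (multipartite a b) = a" and "gp_g' (multipartite a b) = b"
    using assms by (simp_all add: gp_g_multipartite gp_g'_multipartite)
qed

end
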